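(* Let $G$ be a graph and let $V_1,V_2\subseteq V(G)$ be disjoint vertex sets with $|V_1|=|V_2|=m$ such that (1) the induced subgraphs $G[V_1]$ and $G[V_2]$ are empty (have no edges); (2) there exists a graph automorphism $\pi$ of the induced subgraph $G[V_1\cup V_2]$ such that $\pi(V_1)=V_2$, $\pi(V_2)=V_1$, and $\pi^2=\mathrm{id}$. Let $H_1$ and $H_2$ be any two graphs on $m$ vertices, and for $i\in\{1,2\}$ let $\phi_i:V(H_i)\to V_i$ be a bijection. Let $$G_1=G+\phi_1(E(H_1))+\phi_2(E(H_2)),\qquad G_2=G+\pi(\phi_1(E(H_1)))+\pi(\phi_2(E(H_2))).$$ If $V_1,V_2$ are co-degree cousins in $G$ and $G_1[V_1\cup V_2]$ is a regular graph, then $\phi_{G_1}(\lambda,r)=\phi_{G_2}(\lambda,r)$, where $\phi_{\Gamma}(\lambda,r)$ denotes the generalized characteristic polynomial of a graph $\Gamma$.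
   Context: Graphs are finite, simple and undirected. $G[U]$ is the subgraph of $G$ induced on $U\subseteq V(G)$; $N(u)$ is the set of neighbors of $u$ in $G$; $u\sim v$ means adjacency in $G$. Gluing: for an injective map $\phi:V(H)\to V(G)$, $\phi(E(H))=\{\phi(x)\phi(y): xy\in E(H)\}$; for a set $F$ of edges on vertices in the domain of $\pi$, $\pi(F)=\{\pi(x)\pi(y):xy\in F\}$; and $G+F$ is the graph obtained from $G$ by adding the edges in $F$. Generalized characteristic polynomial: for a graph $\Gamma$ on $n$ vertices with adjacency matrix $A_\Gamma$ and diagonal degree matrix $D_\Gamma$, $\phi_\Gamma(\lambda,r)=\det(\lambda I_n-A_\Gamma+rD_\Gamma)$, a polynomial in $\lambda$ and $r$. Co-degree cousins: disjoint vertex sets $U,W$ of $G$ are co-degree cousins if (i) $|U|=|W|$; (ii) for all $u_i,u_j\in U$, $w_i,w_j\in W$ and $v\in V(G)\setminus(U\cup W)$, $u_i\sim v$ if and only if $u_j\sim v$, and $w_i\sim v$ if and only if $w_j\sim v$; (iii) $|N(u_i)\setminus W|=|N(w_j)\setminus U|$ for all $u_i\in U$, $w_j\in W$. *)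

theory Defs
  imports "Graph_Theory.Graph_Theory" "Jordan_Normal_Form.Determinant"
begin

text \<open>
  Finite simple undirected graphs are the \<^locale>\<open>pair_graph\<close>s of the imported digraph library: finite, loop-free,
  symmetric digraphs without parallel arcs. An undirected edge xy is thus represented by the two arcs
  (x,y) and (y,x), the set of edges of \<open>G\<close> by the symmetric relation \<^term>\<open>parcs G\<close>, and
  the degree of a vertex is its \<^const>\<open>out_degree\<close>.
\<close>

subsection \<open>Graph notions\<close>

definition neighbors :: "'a pair_pre_digraph \<Rightarrow> 'a \<Rightarrow> 'a set" where
  "neighbors G u = {v. u \<rightarrow>\<^bsub>with_proj G\<^esub> v}"

definition empty_graph :: "('a, 'b) pre_digraph \<Rightarrow> bool" where
  "empty_graph \<Gamma> \<longleftrightarrow> arcs \<Gamma> = {}"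

definition regular_graph :: "('a, 'b) pre_digraph \<Rightarrow> bool" where
  "regular_graph \<Gamma> \<longleftrightarrow> (\<exists>d. \<forall>v\<in>verts \<Gamma>. out_degree \<Gamma> v = d)"

definition graph_automorphism :: "('a, 'b) pre_digraph \<Rightarrow> ('a \<Rightarrow> 'a) \<Rightarrow> bool" where
  "graph_automorphism \<Gamma> f \<longleftrightarrow>
     bij_betw f (verts \<Gamma>) (verts \<Gamma>) \<and>
     (\<forall>u\<in>verts \<Gamma>. \<forall>v\<in>verts \<Gamma>. u \<rightarrow>\<^bsub>\<Gamma>\<^esub> v \<longleftrightarrow> f u \<rightarrow>\<^bsub>\<Gamma>\<^esub> f v)"

definition map_edges :: "('a \<Rightarrow> 'b) \<Rightarrow> 'a rel \<Rightarrow> 'b rel" where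
  "map_edges f F = {(f x, f y) | x y. (x, y) \<in> F}"

definition add_edges :: "'a pair_pre_digraph \<Rightarrow> 'a rel \<Rightarrow> 'a pair_pre_digraph" where
  "add_edges G F = \<lparr>pverts = pverts G, parcs = parcs G \<union> F\<rparr>"

definition co_degree_cousins :: "'a pair_pre_digraph \<Rightarrow> 'a set \<Rightarrow> 'a set \<Rightarrow> bool" where
  "co_degree_cousins G U W \<longleftrightarrow>
     U \<subseteq> pverts G \<and> W \<subseteq> pverts G \<and> U \<inter> W = {} \<and>
     card U = card W \<and>
     (\<forall>v \<in> pverts G - (U \<union> W).
        (\<forall>u\<^sub>i\<in>U. \<forall>u\<^sub>j\<in>U. u\<^sub>i \<rightarrow>\<^bsub>with_proj G\<^esub> v \<longleftrightarrow> u\<^sub>j \<rightarrow>\<^bsub>with_proj G\<^esub> v) \<and>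
        (\<forall>w\<^sub>i\<in>W. \<forall>w\<^sub>j\<in>W. w\<^sub>i \<rightarrow>\<^bsub>with_proj G\<^esub> v \<longleftrightarrow> w\<^sub>j \<rightarrow>\<^bsub>with_proj G\<^esub> v)) \<and>
     (\<forall>u\<in>U. \<forall>w\<in>W. card (neighbors G u - W) = card (neighbors G w - U))"

subsection \<open>The generalized characteristic polynomial\<close>

text \<open>
  Matrices are indexed by \<open>0, \<dots>, n - 1\<close>, so the vertices have to be enumerated. The enumeration \<open>f\<close>
  is a parameter of the matrices; the polynomial uses an arbitrary one, and
  \<open>gen_char_poly_eq\<close> below shows that the choice is irrelevant.
\<close>

definition vertex_enumeration :: "'a set \<Rightarrow> (nat \<Rightarrow> 'a) \<Rightarrow> bool" where
  "vertex_enumeration V f \<longleftrightarrow> bij_betw f {0..<card V} V"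

definition adjacency_mat :: "'a pair_pre_digraph \<Rightarrow> (nat \<Rightarrow> 'a) \<Rightarrow> 'r :: comm_ring_1 mat" where
  "adjacency_mat \<Gamma> f = (let n = card (pverts \<Gamma>) in
     mat n n (\<lambda>(i, j). if f i \<rightarrow>\<^bsub>with_proj \<Gamma>\<^esub> f j then 1 else 0))"

definition degree_mat :: "'a pair_pre_digraph \<Rightarrow> (nat \<Rightarrow> 'a) \<Rightarrow> 'r :: comm_ring_1 mat" where
  "degree_mat \<Gamma> f = (let n = card (pverts \<Gamma>) in
     mat n n (\<lambda>(i, j). if i = j then of_nat (out_degree (with_proj \<Gamma>) (f i)) else 0))"

text \<open>
  Polynomials in \<open>\<lambda>\<close> and \<open>r\<close> are elements of \<open>\<int>[r][\<lambda>]\<close>: the outer variable is \<open>\<lambda>\<close>, the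
  inner one is \<open>r\<close>.
\<close>

abbreviation var_lambda :: "int poly poly" where
  "var_lambda \<equiv> [:0, 1:]"

abbreviation var_r :: "int poly poly" where
  "var_r \<equiv> [:[:0, 1:]:]"

definition gen_char_mat :: "'a pair_pre_digraph \<Rightarrow> (nat \<Rightarrow> 'a) \<Rightarrow> int poly poly mat" where
  "gen_char_mat \<Gamma> f =
     var_lambda \<cdot>\<^sub>m 1\<^sub>m (card (pverts \<Gamma>)) - adjacency_mat \<Gamma> f + var_r \<cdot>\<^sub>m degree_mat \<Gamma> f"

definition gen_char_poly :: "'a pair_pre_digraph \<Rightarrow> int poly poly" where
  "gen_char_poly \<Gamma> = det (gen_char_mat \<Gamma> (SOME f. vertex_enumeration (pverts \<Gamma>) f))"

lemma gen_char_poly_eq: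
  assumes "finite (pverts \<Gamma>)" and g: "vertex_enumeration (pverts \<Gamma>) g"
  shows "gen_char_poly \<Gamma> = det (gen_char_mat \<Gamma> g)"
proof -
  define V n f where "V = pverts \<Gamma>" and "n = card (pverts \<Gamma>)"
    and "f = (SOME f. vertex_enumeration (pverts \<Gamma>) f)"
  have "vertex_enumeration (pverts \<Gamma>) f"
    unfolding f_def using someI[of "vertex_enumeration (pverts \<Gamma>)", OF g] by simp
  then have f: "bij_betw f {0..<n} V" by (simp add: vertex_enumeration_def V_def n_def)
  have g': "bij_betw g {0..<n} V" using g by (simp add: vertex_enumeration_def V_def n_def)
  define p where "p = (\<lambda>i. if i \<in> {0..<n} then the_inv_into {0..<n} g (f i) else i)"
  have "bij_betw (the_inv_into {0..<n} g \<circ> f) {0..<n} {0..<n}"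
    using f bij_betw_the_inv_into[OF g'] by (rule bij_betw_trans)
  then have "bij_betw p {0..<n} {0..<n}"
    by (rule bij_betw_cong[THEN iffD1, rotated]) (simp add: p_def)
  then have p: "p permutes {0..<n}"
    by (rule bij_imp_permutes) (simp add: p_def)
  have p_less: "p i < n" if "i < n" for i
    using permutes_in_image[OF p, of i] that by simp
  have gp: "g (p i) = f i" if "i < n" for i
    using that f g' by (auto simp: p_def bij_betw_def intro: f_the_inv_into_f)
  have p_eq: "p i = p j \<longleftrightarrow> i = j" for i j
    using permutes_inj[OF p] by (auto dest: injD)
  define A where "A = gen_char_mat \<Gamma> g"
  have A: "A \<in> carrier_mat n n"
    by (auto simp: A_def gen_char_mat_def degree_mat_def n_def Let_def)
  define B where "B = mat n n (\<lambda>(i, j). A $$ (p i, j))"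
  have B: "B \<in> carrier_mat n n" by (simp add: B_def)
  have fA: "gen_char_mat \<Gamma> f = transpose_mat (mat n n (\<lambda>(i, j). transpose_mat B $$ (p i, j)))"
    by (rule eq_matI)
      (auto simp: A_def B_def gen_char_mat_def adjacency_mat_def degree_mat_def Let_def gp p_eq
        p_less simp flip: n_def)
  have "det (gen_char_mat \<Gamma> f) = det (mat n n (\<lambda>(i, j). transpose_mat B $$ (p i, j)))"
    unfolding fA by (rule det_transpose[of _ n]) simp
  also have "\<dots> = signof p * det (transpose_mat B)"
    using B by (intro det_permute_rows p) simp
  also have "det (transpose_mat B) = signof p * det A"
    using det_transpose[OF B] det_permute_rows[OF A p] by (simp add: B_def)
  also have "signof p * (signof p * det A) = det A"
    by (simp add: sign_def)
  finally show ?thesis by (simp add: gen_char_poly_def f_def A_def)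
qed

end

theory Submission
  imports Defs
begin

text \<open>
  Put \<open>W = V\<^sub>1 \<union> V\<^sub>2\<close> and let \<open>P\<close> be the permutation matrix of \<open>\<pi>\<close> on \<open>W\<close>. Since \<open>\<pi>\<close> is an involutive
  automorphism of \<open>G[W]\<close>, it is an isomorphism from \<open>G\<^sub>1[W]\<close> to \<open>G\<^sub>2[W]\<close>; outside \<open>W \<times> W\<close> the two graphs
  have the same edges. All vertices of \<open>W\<close> have equally many neighbors outside \<open>W\<close>: neither
  \<open>V\<^sub>1\<close> nor \<open>V\<^sub>2\<close> spans an edge of \<open>G\<close>, so the sets compared by co-degree cousins are exactly the
  neighbors outside \<open>W\<close>. As \<open>G\<^sub>1[W]\<close> is regular, all vertices of \<open>W\<close> have one common degree in \<open>G\<^sub>1\<close> and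
  the same one in \<open>G\<^sub>2\<close>. Ordering \<open>W\<close> first, the matrices whose determinants are compared are therefore
  \<open>M\<^sub>1 = [[K, -C], [-C\<^sup>T, X]]\<close> and \<open>M\<^sub>2 = [[P K P, -C], [-C\<^sup>T, X]]\<close>, where \<open>K\<close> has constant row and column
  sums and each column of \<open>C\<close> is constant on \<open>V\<^sub>1\<close> and on \<open>V\<^sub>2\<close>.

  The proof is a form of Godsil-McKay switching. With \<open>J\<close> the all-ones matrix on \<open>W\<close> and
  \<open>m = |V\<^sub>1| = |V\<^sub>2|\<close>, let \<open>S = diag (J - m P, m I)\<close>. On \<open>W\<close>, \<open>S = (J - m I) P\<close>.
  The matrix \<open>J / m - I = 2 J / |W| - I\<close> commutes with \<open>K\<close> and interchanges the two values of every
  column of \<open>C\<close>; \<open>P\<close> interchanges them back and turns \<open>K\<close> into \<open>P K P\<close>. Hence \<open>S M\<^sub>1 = M\<^sub>2 S\<close>, while \<open>S\<^sup>2 = m\<^sup>2 I\<close> shows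
  \<open>det S \<noteq> 0\<close> for \<open>m > 0\<close>, so \<open>det M\<^sub>1 = det M\<^sub>2\<close>; for \<open>m = 0\<close> both graphs are \<open>G\<close>.
  Scaling by \<open>m\<close> avoids denominators, so that the computation takes
  place in the integral domain \<open>\<int>[r][\<lambda>]\<close> itself. The matrix argument is
  \<open>det_vertex_mat_switching\<close>, the degree count is \<open>gen_char_poly_switching\<close>.
\<close>

section \<open>Matrices indexed by vertices\<close>

text \<open>
  Enumerating the index set lets matrix identities be checked vertex by vertex, without choosing an
  order in which \<open>V\<^sub>1\<close> and \<open>V\<^sub>2\<close> form blocks.
\<close>

definition vertex_mat :: "'a set \<Rightarrow> (nat \<Rightarrow> 'a) \<Rightarrow> ('a \<Rightarrow> 'a \<Rightarrow> 'r) \<Rightarrow> 'r mat" where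
  "vertex_mat V f F = mat (card V) (card V) (\<lambda>(i, j). F (f i) (f j))"

lemma vertex_mat_carrier [simp]: "vertex_mat V f F \<in> carrier_mat (card V) (card V)"
  by (simp add: vertex_mat_def)

lemma vertex_mat_cong:
  assumes "vertex_enumeration V f" and "\<And>u v. u \<in> V \<Longrightarrow> v \<in> V \<Longrightarrow> F u v = F' u v"
  shows "vertex_mat V f F = vertex_mat V f F'"
  using assms by (auto simp: vertex_mat_def vertex_enumeration_def intro!: eq_matI dest: bij_betwE)

lemma vertex_mat_mult:
  fixes F F' :: "'a \<Rightarrow> 'a \<Rightarrow> 'r :: comm_ring_1"
  assumes "vertex_enumeration V f"
  shows "vertex_mat V f F * vertex_mat V f F' = vertex_mat V f (\<lambda>u v. \<Sum>x\<in>V. F u x * F' x v)"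
proof (rule eq_matI)
  fix i j
  assume "i < dim_row (vertex_mat V f (\<lambda>u v. \<Sum>x\<in>V. F u x * F' x v))"
    and "j < dim_col (vertex_mat V f (\<lambda>u v. \<Sum>x\<in>V. F u x * F' x v))"
  then have ij: "i < card V" "j < card V" by (simp_all add: vertex_mat_def)
  have "bij_betw f {0..<card V} V" using assms by (simp add: vertex_enumeration_def)
  then have "(\<Sum>x\<in>V. F (f i) x * F' x (f j)) = (\<Sum>k = 0..<card V. F (f i) (f k) * F' (f k) (f j))"
    by (rule sum.reindex_bij_betw[symmetric])
  then show "(vertex_mat V f F * vertex_mat V f F') $$ (i, j)
      = vertex_mat V f (\<lambda>u v. \<Sum>x\<in>V. F u x * F' x v) $$ (i, j)"
    using ij by (simp add: vertex_mat_def scalar_prod_def)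
qed (simp_all add: vertex_mat_def)

text \<open>
  \<open>S F = F' S\<close> gives \<open>det S * det F = det F' * det S\<close>, and \<open>S\<^sup>2 = c I\<close> allows cancelling \<open>det S\<close> without
  an inverse of \<open>S\<close>, hence over any integral domain.
\<close>

lemma det_vertex_mat_eq_if_intertwined:
  fixes F F' S :: "'a \<Rightarrow> 'a \<Rightarrow> 'r :: idom"
  assumes f: "vertex_enumeration V f" and c: "c \<noteq> 0"
    and SS: "\<And>u v. u \<in> V \<Longrightarrow> v \<in> V \<Longrightarrow> (\<Sum>x\<in>V. S u x * S x v) = (if u = v then c else 0)"
    and SF: "\<And>u v. u \<in> V \<Longrightarrow> v \<in> V \<Longrightarrow> (\<Sum>x\<in>V. S u x * F x v) = (\<Sum>x\<in>V. F' u x * S x v)"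
  shows "det (vertex_mat V f F) = det (vertex_mat V f F')"
proof -
  let ?M = "vertex_mat V f"
  have fV: "f i \<in> V" if "i < card V" for i
    using f that by (auto simp: vertex_enumeration_def dest: bij_betwE)
  have finj: "f i = f j \<longleftrightarrow> i = j" if "i < card V" "j < card V" for i j
    using f that by (auto simp: vertex_enumeration_def bij_betw_def inj_on_def)
  have "?M S * ?M S = c \<cdot>\<^sub>m 1\<^sub>m (card V)"
    unfolding vertex_mat_mult[OF f]
    by (rule eq_matI) (auto simp: vertex_mat_def SS fV finj)
  then have "det (?M S) * det (?M S) = c ^ card V"
    by (simp flip: det_mult[of "?M S" "card V" "?M S"])
  with c have det_S: "det (?M S) \<noteq> 0" by force
  have "?M S * ?M F = ?M F' * ?M S"
    unfolding vertex_mat_mult[OF f] by (rule vertex_mat_cong[OF f SF])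
  then have "det (?M S) * det (?M F) = det (?M F') * det (?M S)"
    by (simp flip: det_mult[of _ "card V"])
  with det_S show ?thesis by simp
qed

section \<open>Switching\<close>

text \<open>
  Rows and columns of \<open>F\<close> leading out of \<open>W\<close> take one value on \<open>V\<^sub>1\<close> and one on \<open>V\<^sub>2\<close>, so such a row
  or column sums over \<open>W\<close> to \<open>m (F u v + F (\<pi> u) v)\<close>, as \<open>\<pi>\<close> swaps the two sets. The
  matrix \<open>J / m - P\<close>, where \<open>m = |V\<^sub>1|\<close>, subtracts the value at \<open>\<pi> u\<close> from \<open>1 / m\<close> times this sum and thus returns the
  value at \<open>u\<close>. Within \<open>W\<close> the \<open>J\<close>-terms on both sides equal \<open>t\<close>, and what remains is
  \<open>P F = (P F P) P\<close>.
\<close>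

lemma det_vertex_mat_switching:
  fixes F F' :: "'a \<Rightarrow> 'a \<Rightarrow> 'r :: {idom, ring_char_0}" and V\<^sub>1 V\<^sub>2 :: "'a set"
  defines "W \<equiv> V\<^sub>1 \<union> V\<^sub>2"
  assumes V: "finite V" "vertex_enumeration V f" "W \<subseteq> V" "V\<^sub>1 \<inter> V\<^sub>2 = {}"
    and swap: "\<pi> ` V\<^sub>1 = V\<^sub>2" "\<pi> ` V\<^sub>2 = V\<^sub>1" "\<And>v. v \<in> W \<Longrightarrow> \<pi> (\<pi> v) = v"
    and row_sum: "\<And>u. u \<in> W \<Longrightarrow> (\<Sum>x\<in>W. F u x) = t"
    and col_sum: "\<And>u. u \<in> W \<Longrightarrow> (\<Sum>x\<in>W. F x u) = t"
    and const: "\<And>U u u' v. U = V\<^sub>1 \<or> U = V\<^sub>2 \<Longrightarrow> u \<in> U \<Longrightarrow> u' \<in> U \<Longrightarrow> v \<in> V - W \<Longrightarrow>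
      F u v = F u' v \<and> F v u = F v u'"
    and inside: "\<And>u v. u \<in> W \<Longrightarrow> v \<in> W \<Longrightarrow> F' u v = F (\<pi> u) (\<pi> v)"
    and outside: "\<And>u v. u \<in> V \<Longrightarrow> v \<in> V \<Longrightarrow> u \<notin> W \<or> v \<notin> W \<Longrightarrow> F' u v = F u v"
  shows "det (vertex_mat V f F) = det (vertex_mat V f F')"
proof (cases "W = {}")
  case True
  then show ?thesis using vertex_mat_cong[OF V(2), of F F'] outside by fastforce
next
  case False
  define m :: 'r where "m = of_nat (card V\<^sub>1)"
  have fin: "finite W" "finite V\<^sub>1" "finite V\<^sub>2" using V finite_subset unfolding W_def by auto
  have \<pi>W: "\<pi> u \<in> W" if "u \<in> W" for u using that swap(1,2) unfolding W_def by blast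
  have inj: "inj_on \<pi> W" using swap(3) by (rule inj_on_inverseI)
  have bij: "bij_betw \<pi> W W" using inj swap(1,2) by (auto simp: bij_betw_def W_def)
  have "inj_on \<pi> V\<^sub>1" using inj by (rule inj_on_subset) (simp add: W_def)
  then have card: "card V\<^sub>2 = card V\<^sub>1" using swap(1) card_image by metis
  have m0: "m \<noteq> 0" using False fin card unfolding m_def W_def by auto
  have sum_W: "(\<Sum>x\<in>W. g x) = m * (g u + g (\<pi> u))"
    if u: "u \<in> W" and g: "\<And>U x y. U = V\<^sub>1 \<or> U = V\<^sub>2 \<Longrightarrow> x \<in> U \<Longrightarrow> y \<in> U \<Longrightarrow> g x = g y"
    for g :: "'a \<Rightarrow> 'r" and u
  proof -
    obtain a b where ab: "a \<in> V\<^sub>1" "b \<in> V\<^sub>2" "g a + g b = g u + g (\<pi> u)"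
      using u swap(1,2) unfolding W_def by (metis Un_iff add.commute imageI)
    have "(\<Sum>x\<in>W. g x) = (\<Sum>x\<in>V\<^sub>1. g x) + (\<Sum>x\<in>V\<^sub>2. g x)"
      unfolding W_def using fin V(4) by (intro sum.union_disjoint) auto
    also have "(\<Sum>x\<in>V\<^sub>1. g x) = (\<Sum>x\<in>V\<^sub>1. g a)" using g ab by (intro sum.cong) auto
    also have "(\<Sum>x\<in>V\<^sub>2. g x) = (\<Sum>x\<in>V\<^sub>2. g b)" using g ab by (intro sum.cong) auto
    finally show ?thesis using ab(3) by (simp add: card m_def distrib_left flip: ab(3))
  qed
  \<comment> \<open>\<open>J - m P\<close> on \<open>W\<close>, \<open>m I\<close> on the remaining vertices\<close>
  define S where "S u x = (if u \<in> W
      then (if x \<in> W then 1 else 0) - (if x = \<pi> u then m else 0)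
      else (if x = u then m else 0))" for u x
  have left_W: "(\<Sum>x\<in>V. S u x * g x) = (\<Sum>x\<in>W. g x) - m * g (\<pi> u)" if "u \<in> W" for u and g
  proof -
    have "(\<Sum>x\<in>V. S u x * g x)
        = (\<Sum>x\<in>V. (if x \<in> W then g x else 0) - (if x = \<pi> u then m * g x else 0))"
      using that by (intro sum.cong) (auto simp: S_def algebra_simps)
    also have "\<dots> = (\<Sum>x\<in>W. g x) - m * g (\<pi> u)"
      using V \<pi>W[OF that] by (auto simp: sum_subtractf sum.inter_restrict[symmetric] Int_absorb1)
    finally show ?thesis .
  qed
  have left_out: "(\<Sum>x\<in>V. S u x * g x) = m * g u" if "u \<in> V" "u \<notin> W" for u and g
    using that V(1) by (simp add: S_def if_distrib[of "\<lambda>a. a * _"] cong: if_cong)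
  \<comment> \<open>\<open>P\<close> is symmetric because \<open>\<pi>\<close> is an involution; multiplication by \<open>S\<close> from the right thus reduces to
    multiplication from the left.\<close>
  have S_sym: "S x v = S v x" for x v
    using \<pi>W swap(3) unfolding S_def by auto metis+
  have right: "(\<Sum>x\<in>V. g x * S x v) = (\<Sum>x\<in>V. S v x * g x)" for v g
    by (intro sum.cong refl) (simp only: S_sym[of _ v] mult.commute)
  have card_W: "of_nat (card W) = 2 * m"
    unfolding W_def m_def using fin V(4) card by (simp add: card_Un_disjoint)
  show ?thesis
  proof (rule det_vertex_mat_eq_if_intertwined[OF V(2)])
    show "m * m \<noteq> 0" using m0 by simp
  next
    fix u v assume uv: "u \<in> V" "v \<in> V"
    show "(\<Sum>x\<in>V. S u x * S x v) = (if u = v then m * m else 0)"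
    proof (cases "u \<in> W")
      case u: True
      show ?thesis
      proof (cases "v \<in> W")
        case v: True
        have "(\<Sum>x\<in>W. S x v) = (\<Sum>x\<in>W. 1 - (if x = \<pi> v then m else 0))"
          using v by (intro sum.cong refl) (auto simp: S_sym[of _ v], auto simp: S_def)
        also have "\<dots> = m" using \<pi>W[OF v] fin card_W by (simp add: sum_subtractf)
        finally have "(\<Sum>x\<in>W. S x v) = m" .
        then show ?thesis
          unfolding left_W[OF u] using u v \<pi>W[OF u] swap(3)[OF u]
          by (auto simp: S_def algebra_simps)
      next
        case v: False
        then have "S x v = 0" if "x \<in> W" for x using that \<pi>W[OF that] by (auto simp: S_def)
        then show ?thesis unfolding left_W[OF u] using \<pi>W[OF u] u v by auto
      qed
    next
      case False
      then show ?thesis unfolding left_out[OF uv(1) False] by (simp add: S_def)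
    qed
  next
    fix u v assume uv: "u \<in> V" "v \<in> V"
    show "(\<Sum>x\<in>V. S u x * F x v) = (\<Sum>x\<in>V. F' u x * S x v)"
      unfolding right
    proof (cases "u \<in> W"; cases "v \<in> W")
      assume u: "u \<in> W" and v: "v \<in> W"
      have "(\<Sum>x\<in>W. F' u x) = (\<Sum>x\<in>W. F (\<pi> u) (\<pi> x))"
        using u by (intro sum.cong) (auto simp: inside)
      also have "\<dots> = t"
        using sum.reindex_bij_betw[OF bij, of "F (\<pi> u)"] row_sum[OF \<pi>W[OF u]] by simp
      finally show "(\<Sum>x\<in>V. S u x * F x v) = (\<Sum>x\<in>V. S v x * F' u x)"
        unfolding left_W[OF u] left_W[OF v]
        using u v \<pi>W swap(3) col_sum by (simp add: inside)
    next
      assume u: "u \<in> W" and v: "v \<notin> W"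
      have "(\<Sum>x\<in>W. F x v) = m * (F u v + F (\<pi> u) v)"
        by (rule sum_W[OF u]) (use const uv v in blast)
      then show "(\<Sum>x\<in>V. S u x * F x v) = (\<Sum>x\<in>V. S v x * F' u x)"
        unfolding left_W[OF u] left_out[OF uv(2) v]
        using uv v by (simp add: outside algebra_simps)
    next
      assume u: "u \<notin> W" and v: "v \<in> W"
      have F'u: "F' u x = F u x" if "x \<in> W" for x using outside uv u that V(3) by blast
      have "(\<Sum>x\<in>W. F u x) = m * (F u v + F u (\<pi> v))"
        by (rule sum_W[OF v]) (use const uv u in blast)
      then show "(\<Sum>x\<in>V. S u x * F x v) = (\<Sum>x\<in>V. S v x * F' u x)"
        unfolding left_W[OF v] left_out[OF uv(1) u]
        using v \<pi>W by (simp add: F'u algebra_simps)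
    next
      assume "u \<notin> W" and "v \<notin> W"
      then show "(\<Sum>x\<in>V. S u x * F x v) = (\<Sum>x\<in>V. S v x * F' u x)"
        using uv by (simp add: left_out outside)
    qed
  qed
qed

section \<open>Switching and the generalized characteristic polynomial\<close>

definition gen_char_entry :: "'a pair_pre_digraph \<Rightarrow> 'a \<Rightarrow> 'a \<Rightarrow> int poly poly" where
  "gen_char_entry \<Gamma> u v =
     (if u = v then var_lambda + var_r * of_nat (card (parcs \<Gamma> `` {u})) else 0)
     - (if (u, v) \<in> parcs \<Gamma> then 1 else 0)"

lemma card_arcs_from:
  "card {e \<in> R. fst e = u} = card (R `` {u})"
proof -
  have "{e \<in> R. fst e = u} = Pair u ` (R `` {u})" by auto
  then show ?thesis by (simp add: card_image inj_on_def)
qed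

lemma out_degree_with_proj: "out_degree (with_proj \<Gamma>) u = card (parcs \<Gamma> `` {u})"
  by (simp add: out_degree_def out_arcs_def card_arcs_from)

lemma out_degree_induced:
  assumes "u \<in> W"
  shows "out_degree (with_proj \<Gamma> \<restriction> W) u = card (parcs \<Gamma> `` {u} \<inter> W)"
proof -
  have "out_arcs (with_proj \<Gamma> \<restriction> W) u = {e \<in> parcs \<Gamma> \<inter> W \<times> W. fst e = u}"
    by (auto simp: out_arcs_def)
  moreover have "(parcs \<Gamma> \<inter> W \<times> W) `` {u} = parcs \<Gamma> `` {u} \<inter> W" using assms by auto
  ultimately show ?thesis unfolding out_degree_def by (simp only: card_arcs_from)
qed

lemma dominates_induced:
  "u \<rightarrow>\<^bsub>with_proj \<Gamma> \<restriction> W\<^esub> v \<longleftrightarrow> u \<in> W \<and> v \<in> W \<and> (u, v) \<in> parcs \<Gamma>"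
  by (auto simp: arcs_ends_def arc_to_ends_def)

lemma gen_char_poly_eq_det_vertex_mat:
  assumes "finite (pverts \<Gamma>)" and f: "vertex_enumeration (pverts \<Gamma>) f"
  shows "gen_char_poly \<Gamma> = det (vertex_mat (pverts \<Gamma>) f (gen_char_entry \<Gamma>))"
proof -
  have "f i = f j \<longleftrightarrow> i = j" if "i < card (pverts \<Gamma>)" "j < card (pverts \<Gamma>)" for i j
    using f that by (auto simp: vertex_enumeration_def bij_betw_def inj_on_def)
  then have "gen_char_mat \<Gamma> f = vertex_mat (pverts \<Gamma>) f (gen_char_entry \<Gamma>)"
    by (intro eq_matI) (auto simp: gen_char_mat_def adjacency_mat_def degree_mat_def Let_def
        vertex_mat_def gen_char_entry_def out_degree_with_proj)
  then show ?thesis using gen_char_poly_eq[OF assms] by simp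
qed

text \<open>
  For graphs, constant row sums of \<open>\<lambda> I - A + r D\<close> on \<open>W\<close> mean that both the degree within \<open>W\<close> and the
  total degree are constant on \<open>W\<close>. The latter also makes the diagonals of the two matrices
  agree: \<open>\<pi>\<close> carries the neighbors within \<open>W\<close> from one graph to the other, and the neighbors outside
  \<open>W\<close> are unchanged.
\<close>

lemma gen_char_poly_switching:
  fixes \<Gamma> \<Gamma>' :: "'a pair_pre_digraph" and V\<^sub>1 V\<^sub>2 :: "'a set"
  defines "W \<equiv> V\<^sub>1 \<union> V\<^sub>2"
  assumes fin: "finite (pverts \<Gamma>)" and verts: "pverts \<Gamma>' = pverts \<Gamma>"
    and sub: "parcs \<Gamma> \<subseteq> pverts \<Gamma> \<times> pverts \<Gamma>" and sym: "sym (parcs \<Gamma>)"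
    and W: "W \<subseteq> pverts \<Gamma>" "V\<^sub>1 \<inter> V\<^sub>2 = {}"
    and swap: "\<pi> ` V\<^sub>1 = V\<^sub>2" "\<pi> ` V\<^sub>2 = V\<^sub>1" "\<And>v. v \<in> W \<Longrightarrow> \<pi> (\<pi> v) = v"
    and inside: "\<And>u v. u \<in> W \<Longrightarrow> v \<in> W \<Longrightarrow> (u, v) \<in> parcs \<Gamma>' \<longleftrightarrow> (\<pi> u, \<pi> v) \<in> parcs \<Gamma>"
    and outside: "\<And>u v. u \<notin> W \<or> v \<notin> W \<Longrightarrow> (u, v) \<in> parcs \<Gamma>' \<longleftrightarrow> (u, v) \<in> parcs \<Gamma>"
    and regular: "\<And>u. u \<in> W \<Longrightarrow> card (parcs \<Gamma> `` {u} \<inter> W) = d"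
    and codegree: "\<And>u. u \<in> W \<Longrightarrow> card (parcs \<Gamma> `` {u} - W) = k"
    and cousins: "\<And>U u u' v. U = V\<^sub>1 \<or> U = V\<^sub>2 \<Longrightarrow> u \<in> U \<Longrightarrow> u' \<in> U \<Longrightarrow> v \<in> pverts \<Gamma> - W \<Longrightarrow>
      (u, v) \<in> parcs \<Gamma> \<longleftrightarrow> (u', v) \<in> parcs \<Gamma>"
  shows "gen_char_poly \<Gamma> = gen_char_poly \<Gamma>'"
proof -
  obtain f where "bij_betw f {0..<card (pverts \<Gamma>)} (pverts \<Gamma>)"
    using ex_bij_betw_nat_finite[OF fin] by blast
  then have f: "vertex_enumeration (pverts \<Gamma>) f" by (simp add: vertex_enumeration_def)
  let ?F = "gen_char_entry \<Gamma>" and ?F' = "gen_char_entry \<Gamma>'"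
  define t :: "int poly poly" where "t = var_lambda + var_r * of_nat (d + k) - of_nat d"
  have \<pi>W: "\<pi> u \<in> W" if "u \<in> W" for u using that swap(1,2) unfolding W_def by blast
  have inj: "inj_on \<pi> W" using swap(3) by (rule inj_on_inverseI)
  have finW: "finite W" using W fin finite_subset by blast
  have split: "card (parcs \<Theta> `` {u}) = card (parcs \<Theta> `` {u} \<inter> W) + card (parcs \<Theta> `` {u} - W)"
    if "finite (parcs \<Theta> `` {u})" for \<Theta> :: "'a pair_pre_digraph" and u
    using card_Int_Diff[OF that, of W] .
  have fin_nb: "finite (parcs \<Gamma> `` {u})" for u
    by (rule finite_subset[OF _ fin]) (use sub in auto)
  have deg: "card (parcs \<Gamma> `` {u}) = d + k" if "u \<in> W" for u
    using split[OF fin_nb] regular codegree that by simp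
  have nb_out: "parcs \<Gamma>' `` {u} - W = parcs \<Gamma> `` {u} - W" for u using outside by auto
  have nb_in: "parcs \<Gamma>' `` {u} \<inter> W = \<pi> ` (parcs \<Gamma> `` {\<pi> u} \<inter> W)" if "u \<in> W" for u
  proof (intro equalityI subsetI)
    fix v assume v: "v \<in> parcs \<Gamma>' `` {u} \<inter> W"
    then have "\<pi> v \<in> parcs \<Gamma> `` {\<pi> u} \<inter> W" using inside[of u v] that \<pi>W by simp
    moreover have "v = \<pi> (\<pi> v)" using v swap(3) by simp
    ultimately show "v \<in> \<pi> ` (parcs \<Gamma> `` {\<pi> u} \<inter> W)" by blast
  next
    fix v assume "v \<in> \<pi> ` (parcs \<Gamma> `` {\<pi> u} \<inter> W)"
    then obtain x where x: "v = \<pi> x" "x \<in> W" "(\<pi> u, x) \<in> parcs \<Gamma>" by blast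
    then show "v \<in> parcs \<Gamma>' `` {u} \<inter> W"
      using inside[of u "\<pi> x"] that \<pi>W[of x] swap(3)[of x] by simp
  qed
  have deg': "card (parcs \<Gamma>' `` {u}) = d + k" if "u \<in> W" for u
  proof -
    have "card (parcs \<Gamma>' `` {u} \<inter> W) = d"
      unfolding nb_in[OF that] using regular[OF \<pi>W[OF that]]
      by (subst card_image) (auto intro: inj_on_subset[OF inj])
    moreover have "finite (parcs \<Gamma>' `` {u})"
    proof (rule finite_subset)
      show "parcs \<Gamma>' `` {u} \<subseteq> W \<union> parcs \<Gamma> `` {u}" using outside by auto
    qed (use finW fin_nb in simp)
    ultimately show ?thesis using split[of \<Gamma>' u] codegree[OF that] by (simp add: nb_out)
  qed
  have row: "(\<Sum>x\<in>W. ?F u x) = t" if "u \<in> W" for u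
  proof -
    have "(\<Sum>x\<in>W. ?F u x) = (var_lambda + var_r * of_nat (d + k))
        - (\<Sum>x\<in>W. if x \<in> parcs \<Gamma> `` {u} then 1 else 0)"
      unfolding gen_char_entry_def using that finW by (simp add: sum_subtractf deg)
    also have "(\<Sum>x\<in>W. if x \<in> parcs \<Gamma> `` {u} then 1 else 0 :: int poly poly)
        = of_nat (card (parcs \<Gamma> `` {u} \<inter> W))"
      using finW by (simp add: Int_commute flip: sum.inter_restrict del: Image_singleton_iff)
    finally show ?thesis using regular[OF that] by (simp add: t_def)
  qed
  have F_sym: "?F u v = ?F v u" for u v
    unfolding gen_char_entry_def using sym by (auto dest: symD)
  have "det (vertex_mat (pverts \<Gamma>) f ?F) = det (vertex_mat (pverts \<Gamma>) f ?F')"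
  proof (rule det_vertex_mat_switching[where \<pi> = \<pi> and t = t, OF fin f])
    fix U u u' v
    assume *: "U = V\<^sub>1 \<or> U = V\<^sub>2" "u \<in> U" "u' \<in> U" "v \<in> pverts \<Gamma> - (V\<^sub>1 \<union> V\<^sub>2)"
    then have "u \<noteq> v" "u' \<noteq> v" by auto
    then have "?F u v = ?F u' v" 
      using cousins[of U u u' v] * by (simp add: gen_char_entry_def W_def)
    then show "?F u v = ?F u' v \<and> ?F v u = ?F v u'" by (simp add: F_sym)
  next
    fix u v assume uv: "u \<in> V\<^sub>1 \<union> V\<^sub>2" "v \<in> V\<^sub>1 \<union> V\<^sub>2"
    then show "?F' u v = ?F (\<pi> u) (\<pi> v)"
      using inside deg deg' \<pi>W inj by (auto simp: gen_char_entry_def W_def[symmetric] inj_on_eq_iff)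
  next
    fix u v assume "u \<notin> V\<^sub>1 \<union> V\<^sub>2 \<or> v \<notin> V\<^sub>1 \<union> V\<^sub>2"
    then have *: "u \<notin> W \<or> v \<notin> W" by (simp add: W_def)
    have "parcs \<Gamma>' `` {u} = parcs \<Gamma> `` {u}" if "u = v"
      using * that outside[of u] by blast
    then show "?F' u v = ?F u v" by (simp add: gen_char_entry_def outside[OF *])
  next
    fix u assume "u \<in> V\<^sub>1 \<union> V\<^sub>2"
    then show "(\<Sum>x\<in>V\<^sub>1 \<union> V\<^sub>2. ?F u x) = t" "(\<Sum>x\<in>V\<^sub>1 \<union> V\<^sub>2. ?F x u) = t"
      using row[of u] unfolding W_def F_sym[of _ u] by blast+
  qed (use W swap in \<open>auto simp: W_def\<close>)
  then show ?thesis
    using gen_char_poly_eq_det_vertex_mat[of \<Gamma> f] gen_char_poly_eq_det_vertex_mat[of \<Gamma>' f] fin f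
    by (simp add: verts)
qed

section \<open>Glued graphs\<close>

lemma map_edges_subset:
  assumes "parcs H \<subseteq> pverts H \<times> pverts H" and "bij_betw \<phi> (pverts H) U"
  shows "map_edges \<phi> (parcs H) \<subseteq> U \<times> U"
  using assms by (auto simp: map_edges_def dest: bij_betwE)

lemma sym_map_edges: "sym F \<Longrightarrow> sym (map_edges \<phi> F)"
  unfolding sym_def map_edges_def by blast

lemma map_edges_Un: "map_edges \<phi> (E \<union> F) = map_edges \<phi> E \<union> map_edges \<phi> F"
  unfolding map_edges_def by blast

lemma map_edges_involution:
  assumes "F \<subseteq> W \<times> W" and "\<And>v. v \<in> W \<Longrightarrow> \<pi> (\<pi> v) = v" and "u \<in> W" "v \<in> W"
  shows "(u, v) \<in> map_edges \<pi> F \<longleftrightarrow> (\<pi> u, \<pi> v) \<in> F"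
proof
  assume "(u, v) \<in> map_edges \<pi> F"
  then obtain x y where "(x, y) \<in> F" "u = \<pi> x" "v = \<pi> y" by (auto simp: map_edges_def)
  then show "(\<pi> u, \<pi> v) \<in> F" using assms by auto
next
  assume "(\<pi> u, \<pi> v) \<in> F"
  then show "(u, v) \<in> map_edges \<pi> F" using assms unfolding map_edges_def by force
qed

theorem corollary2p12:
  fixes G :: "'a pair_pre_digraph"
    and H\<^sub>1 :: "'b pair_pre_digraph"
    and H\<^sub>2 :: "'c pair_pre_digraph"
    and V\<^sub>1 V\<^sub>2 :: "'a set"
    and \<pi> :: "'a \<Rightarrow> 'a"
    and \<phi>\<^sub>1 :: "'b \<Rightarrow> 'a"
    and \<phi>\<^sub>2 :: "'c \<Rightarrow> 'a"
    and m :: nat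
    and G\<^sub>1 G\<^sub>2 :: "'a pair_pre_digraph"
  assumes "pair_graph G"
    and "V\<^sub>1 \<subseteq> pverts G" and "V\<^sub>2 \<subseteq> pverts G" and "V\<^sub>1 \<inter> V\<^sub>2 = {}"
    and "card V\<^sub>1 = m" and "card V\<^sub>2 = m"
    and "empty_graph (with_proj G \<restriction> V\<^sub>1)" and "empty_graph (with_proj G \<restriction> V\<^sub>2)"
    and "graph_automorphism (with_proj G \<restriction> (V\<^sub>1 \<union> V\<^sub>2)) \<pi>"
    and "\<pi> ` V\<^sub>1 = V\<^sub>2" and "\<pi> ` V\<^sub>2 = V\<^sub>1"
    and "\<forall>v \<in> V\<^sub>1 \<union> V\<^sub>2. \<pi> (\<pi> v) = v"
    and "pair_graph H\<^sub>1" and "card (pverts H\<^sub>1) = m"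
    and "pair_graph H\<^sub>2" and "card (pverts H\<^sub>2) = m"
    and "bij_betw \<phi>\<^sub>1 (pverts H\<^sub>1) V\<^sub>1" and "bij_betw \<phi>\<^sub>2 (pverts H\<^sub>2) V\<^sub>2"
    and "G\<^sub>1 = add_edges (add_edges G (map_edges \<phi>\<^sub>1 (parcs H\<^sub>1))) (map_edges \<phi>\<^sub>2 (parcs H\<^sub>2))"
    and "G\<^sub>2 = add_edges (add_edges G (map_edges \<pi> (map_edges \<phi>\<^sub>1 (parcs H\<^sub>1))))
                 (map_edges \<pi> (map_edges \<phi>\<^sub>2 (parcs H\<^sub>2)))"
    and "co_degree_cousins G V\<^sub>1 V\<^sub>2"
    and "regular_graph (with_proj G\<^sub>1 \<restriction> (V\<^sub>1 \<union> V\<^sub>2))"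
  shows "gen_char_poly G\<^sub>1 = gen_char_poly G\<^sub>2"
proof -
  define W where "W = V\<^sub>1 \<union> V\<^sub>2"
  define E where "E = map_edges \<phi>\<^sub>1 (parcs H\<^sub>1) \<union> map_edges \<phi>\<^sub>2 (parcs H\<^sub>2)"
  interpret G: pair_graph G by fact
  have arcs: "parcs H \<subseteq> pverts H \<times> pverts H \<and> sym (parcs H)" if "pair_graph H"
    for H :: "'x pair_pre_digraph"
  proof -
    interpret pair_graph H by fact
    have "sym (parcs H)" using sym_arcs by (simp add: symmetric_def)
    then show ?thesis using in_arcsD1 in_arcsD2 by auto
  qed
  have EW: "E \<subseteq> W \<times> W"
    using map_edges_subset[OF conjunct1[OF arcs[OF assms(13)]] assms(17)]
      map_edges_subset[OF conjunct1[OF arcs[OF assms(15)]] assms(18)]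
    unfolding E_def W_def by blast
  have E_sym: "sym E"
    unfolding E_def using arcs[OF assms(13)] arcs[OF assms(15)] by (intro sym_Un sym_map_edges) auto
  have swap: "\<pi> (\<pi> v) = v" if "v \<in> W" for v using assms(12) that by (simp add: W_def)
  have \<pi>W: "\<pi> u \<in> W" if "u \<in> W" for u using that assms(10,11) unfolding W_def by blast
  have G1: "pverts G\<^sub>1 = pverts G" "parcs G\<^sub>1 = parcs G \<union> E"
    by (auto simp: assms(19) add_edges_def E_def)
  have G2: "pverts G\<^sub>2 = pverts G" "parcs G\<^sub>2 = parcs G \<union> map_edges \<pi> E"
    by (simp_all add: assms(20) add_edges_def E_def map_edges_Un Un_assoc)
  have \<pi>E: "map_edges \<pi> E \<subseteq> W \<times> W" using EW \<pi>W by (auto simp: map_edges_def)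
  have WV: "W \<subseteq> pverts G" using assms(2,3) by (simp add: W_def)
  have aut: "(u, v) \<in> parcs G \<longleftrightarrow> (\<pi> u, \<pi> v) \<in> parcs G" if "u \<in> W" "v \<in> W" for u v
    using assms(9) that \<pi>W unfolding graph_automorphism_def dominates_induced
    by (auto simp: W_def)
  obtain d where d: "card (parcs G\<^sub>1 `` {u} \<inter> W) = d" if "u \<in> W" for u
    using assms(22) out_degree_induced[of _ W G\<^sub>1] unfolding regular_graph_def
    by (auto simp: W_def)
  \<comment> \<open>With no edges inside \<open>V\<^sub>1\<close> or \<open>V\<^sub>2\<close>, removing the opposite set from a neighborhood removes all of \<open>W\<close>.\<close>
  have empty: "parcs G `` {u} \<inter> U = {}" if "U = V\<^sub>1 \<or> U = V\<^sub>2" "u \<in> U" for U u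
    using assms(7,8) that unfolding empty_graph_def by auto
  have nb: "neighbors G u = parcs G `` {u}" for u by (auto simp: neighbors_def)
  have "card (parcs G `` {u} - W) = card (parcs G `` {w} - W)" if "u \<in> V\<^sub>1" "w \<in> V\<^sub>2" for u w
  proof -
    have "parcs G `` {u} - W = neighbors G u - V\<^sub>2" "parcs G `` {w} - W = neighbors G w - V\<^sub>1"
      using empty[of V\<^sub>1 u] empty[of V\<^sub>2 w] that unfolding nb W_def by auto
    then show ?thesis using assms(21) that unfolding co_degree_cousins_def by simp
  qed
  \<comment> \<open>Two vertices on the same side are compared through a vertex of the other side.\<close>
  then have "card (parcs G `` {u} - W) = card (parcs G `` {u'} - W)" if "u \<in> W" "u' \<in> W" for u u'
    using that assms(10,11) unfolding W_def by (metis Un_iff imageI)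
  then obtain k where k: "card (parcs G `` {u} - W) = k" if "u \<in> W" for u by metis
  have out: "parcs G\<^sub>1 `` {u} - W = parcs G `` {u} - W" for u using EW by (auto simp: G1)
  show ?thesis
  proof (rule gen_char_poly_switching[where V\<^sub>1 = V\<^sub>1 and V\<^sub>2 = V\<^sub>2 and \<pi> = \<pi> and d = d and k = k,
        folded W_def])
    show "finite (pverts G\<^sub>1)" by (simp add: G1)
    show "parcs G\<^sub>1 \<subseteq> pverts G\<^sub>1 \<times> pverts G\<^sub>1" using arcs[OF assms(1)] EW WV by (auto simp: G1)
    show "sym (parcs G\<^sub>1)" using arcs[OF assms(1)] E_sym by (simp add: G1 sym_Un)
    show "(u, v) \<in> parcs G\<^sub>2 \<longleftrightarrow> (\<pi> u, \<pi> v) \<in> parcs G\<^sub>1" if "u \<in> W" "v \<in> W" for u v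
      using aut[OF that] map_edges_involution[OF EW swap that] by (simp add: G1 G2)
    show "(u, v) \<in> parcs G\<^sub>2 \<longleftrightarrow> (u, v) \<in> parcs G\<^sub>1" if "u \<notin> W \<or> v \<notin> W" for u v
      using EW \<pi>E that by (auto simp: G1 G2)
    show "(u, v) \<in> parcs G\<^sub>1 \<longleftrightarrow> (u', v) \<in> parcs G\<^sub>1"
      if "U = V\<^sub>1 \<or> U = V\<^sub>2" "u \<in> U" "u' \<in> U" "v \<in> pverts G\<^sub>1 - W" for U u u' v
    proof -
      have "v \<in> pverts G - (V\<^sub>1 \<union> V\<^sub>2)" using that(4) by (simp add: G1 W_def)
      then have "u \<rightarrow>\<^bsub>with_proj G\<^esub> v \<longleftrightarrow> u' \<rightarrow>\<^bsub>with_proj G\<^esub> v"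
        using assms(21) that(1-3) unfolding co_degree_cousins_def by blast
      then have "(u, v) \<in> parcs G \<longleftrightarrow> (u', v) \<in> parcs G" by simp
      then show ?thesis using EW that by (auto simp: G1)
    qed
  qed (use assms(4,10,11) swap d k WV in \<open>simp_all add: G1 G2 out[unfolded G1]\<close>)
qed

end
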